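(* Let $\alpha \in (\frac13,1)$, $\beta \in (0,1)$, $c \in (0,\frac12]$ and $\Delta := 1$, and let $f : \mathbb{R}^{2\times 2} \to \mathbb{R}$ be defined by $$f(X) := \frac{(X_{1,1}-2)^2 + (X_{2,2}-3)^2 + (X_{1,2}-X_{2,1})^2}{2}.$$ Consider the minimization of $f$ on $\mathbb{R}^{2\times 2}_{\le 1}$. Starting from $X_0 := \operatorname{diag}(1,0)$ and using $\bar\alpha := \underline{\alpha} := \alpha$, $\beta$, $c$ and $\Delta$, the algorithm $\mathrm{P}^2\mathrm{GDR}$ produces the sequence $(X_i)_{i\in\mathbb{N}}$ defined by $X_i := \operatorname{diag}(0, 3-3(1-\alpha)^i)$ for every $i \in \mathbb{N}\setminus\{0\}$. In particular, $(X_i)_{i\in\mathbb{N}}$ converges to $\operatorname{diag}(0,3)$, $\lim_{i\to\infty} \mathrm{s}_f(X_i) = 0$, and $\mathrm{s}_f(\operatorname{diag}(0,3)) = 0$.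
   Context: $\mathbb{N}$ includes $0$. $\mathbb{R}^{2\times 2}$ carries the Frobenius inner product and $\|\cdot\|$ is the Frobenius norm; gradients are taken with respect to this inner product. $\mathbb{R}^{2\times 2}_{\le 1} := \{X \in \mathbb{R}^{2\times 2} \mid \operatorname{rank} X \le 1\}$ and, for an integer $s \ge 0$, $\mathbb{R}^{2\times 2}_{s} := \{X \in \mathbb{R}^{2\times 2} \mid \operatorname{rank} X = s\}$. For a nonempty set $\mathcal{S} \subseteq \mathbb{R}^{2\times 2}$ and $X \in \mathbb{R}^{2\times 2}$, $P_{\mathcal{S}}(X) := \operatorname{argmin}_{Y\in\mathcal{S}} \|X-Y\|$ (a set, identified with its element when it is a singleton). For $X \in \mathcal{S}$, the tangent cone $T_{\mathcal{S}}(X)$ is the set of all $V \in \mathbb{R}^{2\times 2}$ for which there exist $(t_i)_{i\in\mathbb{N}}$ in $(0,\infty)$ converging to $0$ and $(V_i)_{i\in\mathbb{N}}$ in $\mathbb{R}^{2\times 2}$ converging to $V$ such that $X+t_iV_i \in \mathcal{S}$ for every $i$; it is a closed cone, and for a closed cone $\mathcal{C}$ all elements of $P_{\mathcal{C}}(X)$ have the same norm. Stationarity measure: for $X \in \mathbb{R}^{2\times 2}_{\le 1}$, $\mathrm{s}_f(X) := \|P_{T_{\mathbb{R}^{2\times 2}_{\le 1}}(X)}(-\nabla f(X))\|$ (norm of any element of this projection). $\Delta$-rank: for $X \ne 0$ with singular values $\sigma_1(X) \ge \sigma_2(X)$, $\operatorname{rank}_\Delta X := \max\{j \in \{1,\dots,\operatorname{rank}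 X\} \mid \sigma_j(X) > \Delta\}$, with the convention that the maximum of the empty set is $0$; $\operatorname{rank}_\Delta 0_{2\times 2} := 0$. $\mathrm{P}^2\mathrm{GD}$ map with parameters $0 < \underline{\alpha} \le \bar\alpha < \infty$, $\beta, c \in (0,1)$: given $X \in \mathbb{R}^{2\times 2}_{\le 1}$ with $\mathrm{s}_f(X) > 0$, choose $G \in P_{T_{\mathbb{R}^{2\times 2}_{\le 1}}(X)}(-\nabla f(X))$, a step size $\alpha \in [\underline{\alpha},\bar\alpha]$, and $Y \in P_{\mathbb{R}^{2\times 2}_{\le 1}}(X+\alpha G)$; while $f(Y) > f(X) - c\,\alpha\,\mathrm{s}_f(X)^2$, replace $\alpha$ by $\alpha\beta$ and choose a new $Y \in P_{\mathbb{R}^{2\times 2}_{\le 1}}(X+\alpha G)$; then return $Y$. The set of all possible outputs is $\mathrm{P}^2\mathrm{GD}(X; f,\underline{\alpha},\bar\alpha,\beta,c)$. $\mathrm{P}^2\mathrm{GDR}$ map with the same parameters and $\Delta \in (0,\infty)$: given $X \in \mathbb{R}^{2\times 2}_{\le 1}$ with $\mathrm{s}_f(X) > 0$, for each $j \in \{0,\dots,\operatorname{rank} X - \operatorname{rank}_\Delta X\}$ choose $\hat X^j \in P_{\mathbb{R}^{2\times 2}_{\operatorname{rank} X - j}}(X)$ and $\tilde X^j \in \mathrm{P}^2\mathrm{GD}(\hat X^j; f,\underline{\alpha},\bar\alpha,\beta,c)$; then return some $Y$ minimizing $f$ over the finite set of all the $\tilde X^j$. The set of all possible outputs is $\mathrm{P}^2\mathrm{GDR}(X;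 f,\underline{\alpha},\bar\alpha,\beta,c,\Delta)$. The algorithm $\mathrm{P}^2\mathrm{GDR}$ (with stopping tolerance $0$): starting from $X_0 \in \mathbb{R}^{2\times 2}_{\le 1}$, as long as $\mathrm{s}_f(X_i) > 0$, choose $X_{i+1} \in \mathrm{P}^2\mathrm{GDR}(X_i; f,\underline{\alpha},\bar\alpha,\beta,c,\Delta)$. "Produces the sequence $(X_i)$" means that the algorithm never stops and that its iterates are the $X_i$. *)

theory Defs
  imports "HOL-Analysis.Analysis"
begin

text \<open>
  On \<^typ>\<open>real^2^2\<close> the library's \<^const>\<open>inner\<close> and \<^const>\<open>norm\<close> are the Frobenius inner product
  and the Frobenius norm.
\<close>

definition gradient :: "('a::real_inner \<Rightarrow> real) \<Rightarrow> 'a \<Rightarrow> 'a" where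
  "gradient f x = (THE D. GDERIV f x :> D)"

definition proj :: "'a::real_normed_vector set \<Rightarrow> 'a \<Rightarrow> 'a set" where
  "proj S X = {Y. is_arg_min (\<lambda>Y. norm (X - Y)) (\<lambda>Y. Y \<in> S) Y}"

definition tangent_cone :: "'a::real_normed_vector set \<Rightarrow> 'a \<Rightarrow> 'a set" where
  "tangent_cone S X = {V. \<exists>(t :: nat \<Rightarrow> real) (W :: nat \<Rightarrow> 'a).
     (\<forall>i. 0 < t i) \<and> t \<longlonglongrightarrow> 0 \<and> W \<longlonglongrightarrow> V \<and> (\<forall>i. X + t i *\<^sub>R W i \<in> S)}"

definition rank_le1 :: "(real^2^2) set" where
  "rank_le1 = {X. rank X \<le> 1}"

definition rank_eq :: "nat \<Rightarrow> (real^2^2) set" where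
  "rank_eq s = {X. rank X = s}"

definition diag2 :: "real \<Rightarrow> real \<Rightarrow> real^2^2" where
  "diag2 a b = vector [vector [a, 0], vector [0, b]]"

text \<open>The singular values, in decreasing order, are read off any singular value decomposition.\<close>

definition singular_values :: "real^2^2 \<Rightarrow> real^2" where
  "singular_values X = (THE \<sigma>. \<sigma> $ 1 \<ge> \<sigma> $ 2 \<and> \<sigma> $ 2 \<ge> 0 \<and>
     (\<exists>U V. orthogonal_matrix U \<and> orthogonal_matrix V \<and>
            X = U ** diag2 (\<sigma> $ 1) (\<sigma> $ 2) ** transpose V))"

text \<open>For \<open>X = 0\<close> the index range is empty, so the value is \<open>0\<close> as required.\<close>

definition rank_Delta :: "real \<Rightarrow> real^2^2 \<Rightarrow> nat" where
  "rank_Delta \<Delta> X =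
     (let J = {j \<in> {1..rank X}. singular_values X $ of_nat j > \<Delta>}
      in if J = {} then 0 else Max J)"

text \<open>
  The tangent cone is a closed cone, so its projections exist and all have the same norm; the
  choice made here is therefore immaterial.
\<close>

definition stat_measure :: "(real^2^2 \<Rightarrow> real) \<Rightarrow> real^2^2 \<Rightarrow> real" where
  "stat_measure f X = norm (SOME G. G \<in> proj (tangent_cone rank_le1 X) (- gradient f X))"

text \<open>
  \<open>backtracking f \<beta> c X G \<alpha> Y\<close>: the line search along \<open>G\<close> entered with step size \<open>\<alpha>\<close> can
  terminate with output \<open>Y\<close>. A fresh projection is chosen after every reduction of the step size.
\<close>

inductive backtracking ::
  "(real^2^2 \<Rightarrow> real) \<Rightarrow> real \<Rightarrow> real \<Rightarrow> real^2^2 \<Rightarrow> real^2^2 \<Rightarrow> real \<Rightarrow> real^2^2 \<Rightarrow> bool"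
  for f \<beta> c X G where
  accept: "\<lbrakk>Y \<in> proj rank_le1 (X + \<alpha> *\<^sub>R G); f Y \<le> f X - c * \<alpha> * (stat_measure f X)\<^sup>2\<rbrakk>
    \<Longrightarrow> backtracking f \<beta> c X G \<alpha> Y"
| reduce: "\<lbrakk>Z \<in> proj rank_le1 (X + \<alpha> *\<^sub>R G); f Z > f X - c * \<alpha> * (stat_measure f X)\<^sup>2;
            backtracking f \<beta> c X G (\<alpha> * \<beta>) Y\<rbrakk>
    \<Longrightarrow> backtracking f \<beta> c X G \<alpha> Y"

text \<open>
  Both maps return the set of all possible outputs. They take as input only non-stationary
  matrices of rank at most one; outside that domain the set of outputs is empty.
\<close>

definition P2GD ::
  "(real^2^2 \<Rightarrow> real) \<Rightarrow> real \<Rightarrow> real \<Rightarrow> real \<Rightarrow> real \<Rightarrow> real^2^2 \<Rightarrow> (real^2^2) set" where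
  "P2GD f \<alpha>min \<alpha>max \<beta> c X =
     {Y. X \<in> rank_le1 \<and> stat_measure f X > 0 \<and>
         (\<exists>G \<in> proj (tangent_cone rank_le1 X) (- gradient f X).
            \<exists>\<alpha> \<in> {\<alpha>min..\<alpha>max}. backtracking f \<beta> c X G \<alpha> Y)}"

definition P2GDR ::
  "(real^2^2 \<Rightarrow> real) \<Rightarrow> real \<Rightarrow> real \<Rightarrow> real \<Rightarrow> real \<Rightarrow> real \<Rightarrow> real^2^2 \<Rightarrow> (real^2^2) set" where
  "P2GDR f \<alpha>min \<alpha>max \<beta> c \<Delta> X =
     {Y. X \<in> rank_le1 \<and> stat_measure f X > 0 \<and>
         (\<exists>(Xhat :: nat \<Rightarrow> real^2^2) (Xtilde :: nat \<Rightarrow> real^2^2).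
            (\<forall>j \<in> {0..rank X - rank_Delta \<Delta> X}.
               Xhat j \<in> proj (rank_eq (rank X - j)) X \<and>
               Xtilde j \<in> P2GD f \<alpha>min \<alpha>max \<beta> c (Xhat j)) \<and>
            is_arg_min f (\<lambda>Z. Z \<in> Xtilde ` {0..rank X - rank_Delta \<Delta> X}) Y)}"

text \<open>\<open>X 0, \<dots>, X n\<close> is a possible outcome of the first \<open>n\<close> iterations started at \<open>X0\<close>.\<close>

definition P2GDR_run ::
  "(real^2^2 \<Rightarrow> real) \<Rightarrow> real \<Rightarrow> real \<Rightarrow> real \<Rightarrow> real \<Rightarrow> real \<Rightarrow> real^2^2 \<Rightarrow> nat \<Rightarrow>
   (nat \<Rightarrow> real^2^2) \<Rightarrow> bool" where
  "P2GDR_run f \<alpha>min \<alpha>max \<beta> c \<Delta> X0 n X \<longleftrightarrow>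
     X0 \<in> rank_le1 \<and> X 0 = X0 \<and>
     (\<forall>i<n. stat_measure f (X i) > 0 \<and> X (Suc i) \<in> P2GDR f \<alpha>min \<alpha>max \<beta> c \<Delta> (X i))"

text \<open>
  The algorithm involves choices. It is said to produce \<open>X\<close> if \<open>X\<close> is an execution that never
  stops and if no choices lead to different iterates. The second condition quantifies over finite
  runs, so that executions stopping after finitely many iterations are excluded as well.
\<close>

definition P2GDR_produces ::
  "(real^2^2 \<Rightarrow> real) \<Rightarrow> real \<Rightarrow> real \<Rightarrow> real \<Rightarrow> real \<Rightarrow> real \<Rightarrow> real^2^2 \<Rightarrow>
   (nat \<Rightarrow> real^2^2) \<Rightarrow> bool" where
  "P2GDR_produces f \<alpha>min \<alpha>max \<beta> c \<Delta> X0 X \<longleftrightarrow>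
     (\<forall>n. P2GDR_run f \<alpha>min \<alpha>max \<beta> c \<Delta> X0 n X) \<and>
     (\<forall>n Y. P2GDR_run f \<alpha>min \<alpha>max \<beta> c \<Delta> X0 n Y \<longrightarrow> (\<forall>i\<le>n. Y i = X i))"

end

theory Submission
  imports Defs
begin

text \<open>
  Only the first step drops the rank: the \<open>1\<close>-rank of \<open>diag(1,0)\<close> is \<open>0\<close>, so both \<open>diag(1,0)\<close> and
  \<open>0\<close> are tried. The former moves to \<open>diag(1 + \<alpha>, 0)\<close>, the latter to \<open>diag(0, 3\<alpha>)\<close>, and for
  \<open>\<alpha> > 1/3\<close> the latter has the smaller cost. From then on the nonzero singular value exceeds \<open>1\<close>, so
  no rank reduction is tried again, and the projected negative gradient at \<open>diag(0,b)\<close> is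
  \<open>diag(0, 3 - b)\<close>: every step contracts \<open>3 - b\<close> by \<open>1 - \<alpha>\<close>. All iterates stay on a line inside the
  feasible set and the cost is quadratic along it, so \<open>c \<le> 1/2\<close> makes the line search accept its
  first trial.
\<close>

section \<open>Gradients, projections and singular values\<close>

lemma gradient_eqI:
  assumes "GDERIV f x :> D"
  shows "gradient f x = D"
  unfolding gradient_def
proof (rule the_equality)
  fix E assume "GDERIV f x :> E"
  then have "(\<lambda>h. inner h E) = (\<lambda>h. inner h D)"
    using assms has_derivative_unique unfolding gderiv_def by blast
  then have "\<forall>h. inner h E = inner h D" by metis
  then show "E = D" by (simp add: vector_eq_ldot)
qed (rule assms)

text \<open>The second hypothesis says that every other point of \<open>S\<close> is strictly
  farther from \<open>X\<close>, so minimality and uniqueness come together.\<close>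

lemma proj_eq_singletonI:
  assumes "Y \<in> S" "\<And>Z. Z \<in> S \<Longrightarrow> norm (X - Z) \<le> norm (X - Y) \<Longrightarrow> Z = Y"
  shows "proj S X = {Y}"
  using assms unfolding proj_def is_arg_min_linorder
  by (auto intro: linear less_imp_le) (metis linear)

lemma proj_self: "X \<in> S \<Longrightarrow> proj S X = {X}"
  by (rule proj_eq_singletonI) auto

section \<open>Two-by-two matrices: entries, diagonal matrices and rank\<close>

lemma norm_matrix_2_square:
  fixes A :: "real^2^2"
  shows "(norm A)\<^sup>2 = (A$1$1)\<^sup>2 + (A$1$2)\<^sup>2 + (A$2$1)\<^sup>2 + (A$2$2)\<^sup>2"
  by (simp add: power2_norm_eq_inner inner_vec_def sum_2) (simp add: power2_eq_square)

lemma matrix_2_eq_iff: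
  fixes A B :: "real^2^2"
  shows "A = B \<longleftrightarrow> A$1$1 = B$1$1 \<and> A$1$2 = B$1$2 \<and> A$2$1 = B$2$1 \<and> A$2$2 = B$2$2"
  by (auto simp: vec_eq_iff forall_2)

lemma diag2_nth [simp]:
  "diag2 a b $ 1 $ 1 = a" "diag2 a b $ 1 $ 2 = 0" "diag2 a b $ 2 $ 1 = 0" "diag2 a b $ 2 $ 2 = b"
  by (simp_all add: diag2_def)

lemma zero_eq_diag2: "0 = diag2 0 0"
  by (simp add: matrix_2_eq_iff)

lemma diag2_add_scaleR: "diag2 a b + t *\<^sub>R diag2 c d = diag2 (a + t * c) (b + t * d)"
  by (simp add: matrix_2_eq_iff)

lemma uminus_diag2: "- diag2 a b = diag2 (- a) (- b)"
  by (simp add: matrix_2_eq_iff)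

text \<open>In dimension two, rank at most one means singular; feasibility thus becomes a polynomial
  equation in the entries.\<close>

lemma rank_le1_iff: "A \<in> rank_le1 \<longleftrightarrow> A$1$1 * A$2$2 = A$1$2 * A$2$1"
proof -
  have "A \<in> rank_le1 \<longleftrightarrow> rank A < CARD(2)" by (auto simp: rank_le1_def)
  also have "\<dots> \<longleftrightarrow> det A = 0" by (simp only: det_eq_0_rank)
  finally show ?thesis by (simp add: det_2)
qed

lemma rank_eq_1_iff: "rank A = 1 \<longleftrightarrow> A \<in> rank_le1 \<and> A \<noteq> 0" for A :: "real^2^2"
  using rank_eq_0[of A] by (auto simp: rank_le1_def)

lemma det_diag2: "det (diag2 a b) = a * b"
  by (simp add: det_2)

text \<open>\<open>U\<close> cancels inside the product of the transpose of \<open>A\<close> with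
  \<open>A\<close>, and \<open>V\<close> cancels by cyclicity of the trace.\<close>

lemma trace_orthogonal_conj:
  fixes U V D :: "real^'n^'n"
  assumes U: "orthogonal_matrix U" and V: "orthogonal_matrix V"
    and A: "A = U ** D ** transpose V"
  shows "trace (transpose A ** A) = trace (transpose D ** D)"
proof -
  have "transpose A ** A = (V ** transpose D) ** (transpose U ** U) ** (D ** transpose V)"
    by (simp add: A matrix_transpose_mul matrix_mul_assoc)
  also have "transpose U ** U = mat 1"
    using U by (simp add: orthogonal_matrix_def)
  finally have "transpose A ** A = V ** (transpose D ** D ** transpose V)"
    by (simp add: matrix_mul_assoc)
  then have "trace (transpose A ** A) = trace ((transpose D ** D ** transpose V) ** V)"
    using trace_mul_sym by metis
  also have "(transpose D ** D ** transpose V) ** V = transpose D ** D"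
    using V by (metis matrix_mul_assoc matrix_mul_rid orthogonal_matrix_def)
  finally show ?thesis .
qed

text \<open>
  Sum of squares and product of the singular values are read off the trace of \<open>A\<^sup>T A\<close> and the
  determinant; they determine \<open>(\<sigma>\<^sub>1 + \<sigma>\<^sub>2)\<^sup>2\<close> and \<open>(\<sigma>\<^sub>1 - \<sigma>\<^sub>2)\<^sup>2\<close>.
\<close>

lemma singular_values_eqI:
  assumes U: "orthogonal_matrix U" and V: "orthogonal_matrix V"
    and A: "A = U ** diag2 a b ** transpose V" and ab: "a \<ge> b" "b \<ge> 0"
  shows "singular_values A = vector [a, b]"
  unfolding singular_values_def
proof (rule the_equality)
  show "vector [a, b] $ 1 \<ge> (vector [a, b] :: real^2) $ 2 \<and> (vector [a, b] :: real^2) $ 2 \<ge> 0 \<and>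
     (\<exists>U V. orthogonal_matrix U \<and> orthogonal_matrix V \<and>
       A = U ** diag2 ((vector [a, b] :: real^2) $ 1) ((vector [a, b] :: real^2) $ 2) ** transpose V)"
    using assms by auto
next
  fix s :: "real^2"
  assume s: "s $ 1 \<ge> s $ 2 \<and> s $ 2 \<ge> 0 \<and>
     (\<exists>U V. orthogonal_matrix U \<and> orthogonal_matrix V \<and>
       A = U ** diag2 (s $ 1) (s $ 2) ** transpose V)"
  then obtain P Q where P: "orthogonal_matrix P" and Q: "orthogonal_matrix Q"
    and A': "A = P ** diag2 (s $ 1) (s $ 2) ** transpose Q" by auto
  have tr: "trace (transpose (diag2 x y) ** diag2 x y) = x\<^sup>2 + y\<^sup>2" for x y
    by (simp add: trace_def sum_2 matrix_matrix_mult_def transpose_def power2_eq_square)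
  have abs_det: "\<bar>det A\<bar> = \<bar>x * y\<bar>"
    if "orthogonal_matrix P" "orthogonal_matrix Q" "A = P ** diag2 x y ** transpose Q" for P Q x y
    using det_orthogonal_matrix[OF that(1)] det_orthogonal_matrix[OF that(2)] that(3)
    by (auto simp: det_mul abs_mult det_diag2)
  have sq: "(s$1)\<^sup>2 + (s$2)\<^sup>2 = a\<^sup>2 + b\<^sup>2"
    using trace_orthogonal_conj[OF U V A] trace_orthogonal_conj[OF P Q A'] by (simp add: tr)
  have pr: "s$1 * s$2 = a * b"
    using abs_det[OF U V A] abs_det[OF P Q A'] ab s by simp
  have "(s$1 + s$2)\<^sup>2 = (a + b)\<^sup>2" "(s$1 - s$2)\<^sup>2 = (a - b)\<^sup>2"
    using sq pr by (auto simp: power2_sum power2_diff)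
  then have "s$1 + s$2 = a + b" "s$1 - s$2 = a - b"
    using ab s by (auto simp: power2_eq_iff_nonneg)
  then show "s = vector [a, b]" by (simp add: vec_eq_iff forall_2)
qed

lemma singular_values_diag2_fst:
  assumes "a \<ge> 0" shows "singular_values (diag2 a 0) = vector [a, 0]"
  by (rule singular_values_eqI[of "mat 1" "mat 1"]) (use assms in \<open>auto simp: orthogonal_matrix_id\<close>)

lemma singular_values_diag2_snd:
  assumes "b \<ge> 0" shows "singular_values (diag2 0 b) = vector [b, 0]"
proof -
  \<comment> \<open>The coordinate swap moves the nonzero entry into the first position, as the
    decreasing order of the singular values demands.\<close>
  define S :: "real^2^2" where "S = vector [vector [0, 1], vector [1, 0]]"
  have S: "S$1$1 = 0" "S$1$2 = 1" "S$2$1 = 1" "S$2$2 = 0" by (simp_all add: S_def)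
  have "orthogonal_matrix S"
    by (simp add: orthogonal_matrix matrix_2_eq_iff matrix_matrix_mult_def transpose_def sum_2 S mat_def)
  moreover have "diag2 0 b = S ** diag2 b 0 ** transpose S"
    by (simp add: matrix_2_eq_iff matrix_matrix_mult_def transpose_def sum_2 S)
  ultimately show ?thesis using assms singular_values_eqI by blast
qed

lemma rank_Delta_rank_1:
  assumes "rank A = 1"
  shows "rank_Delta \<Delta> A = (if singular_values A $ 1 > \<Delta> then 1 else 0)"
proof -
  have "{j \<in> {1..rank A}. singular_values A $ of_nat j > \<Delta>}
      = (if singular_values A $ 1 > \<Delta> then {1} else {})"
    using assms by (auto simp: le_Suc_eq)
  then show ?thesis by (simp add: rank_Delta_def Let_def)
qed

section \<open>Tangent cones\<close>

text \<open>The derivative of the determinant at \<open>A\<close> vanishes along \<open>V\<close>: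
  expand det(A + tW) = 0, where det A = 0, divide by t and pass to the limit.\<close>

lemma tangent_cone_rank_le1_linear:
  assumes "A \<in> rank_le1" "V \<in> tangent_cone rank_le1 A"
  shows "A$1$1 * V$2$2 + A$2$2 * V$1$1 = A$1$2 * V$2$1 + A$2$1 * V$1$2"
proof -
  obtain t W where t: "\<And>i. (0::real) < t i" "t \<longlonglongrightarrow> 0" and W: "W \<longlonglongrightarrow> V"
    and AW: "\<And>i. A + t i *\<^sub>R W i \<in> rank_le1"
    using assms(2) unfolding tangent_cone_def by blast
  let ?L = "\<lambda>V::real^2^2. A$1$1 * V$2$2 + A$2$2 * V$1$1 - A$1$2 * V$2$1 - A$2$1 * V$1$2"
  let ?d = "\<lambda>V::real^2^2. V$1$1 * V$2$2 - V$1$2 * V$2$1"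
  have "?L (W i) + t i * ?d (W i) = 0" for i
  proof -
    have "t i * (?L (W i) + t i * ?d (W i)) = 0"
      using AW[of i] assms(1) by (simp add: rank_le1_iff algebra_simps)
    then show ?thesis using t(1)[of i] by simp
  qed
  moreover have "(\<lambda>i. ?L (W i) + t i * ?d (W i)) \<longlonglongrightarrow> ?L V + 0 * ?d V"
    by (intro tendsto_intros W t)
  ultimately have "?L V = 0" by (simp add: LIMSEQ_const_iff)
  then show ?thesis by simp
qed

text \<open>At the origin the linear condition is void. There det(tW) = t^2 det W, so each
  \<open>W i\<close> is singular, and so is the limit.\<close>

lemma tangent_cone_rank_le1_zero:
  assumes "V \<in> tangent_cone rank_le1 0"
  shows "V \<in> rank_le1"
proof -
  obtain t W where t: "\<And>i. (0::real) < t i" and W: "W \<longlonglongrightarrow> V"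
    and tW: "\<And>i. t i *\<^sub>R W i \<in> rank_le1"
    using assms unfolding tangent_cone_def by auto
  let ?d = "\<lambda>V::real^2^2. V$1$1 * V$2$2 - V$1$2 * V$2$1"
  have "?d (W i) = 0" for i
    using tW[of i] t[of i] by (simp add: rank_le1_iff algebra_simps)
  moreover have "(\<lambda>i. ?d (W i)) \<longlonglongrightarrow> ?d V"
    by (intro tendsto_intros W)
  ultimately have "?d V = 0" by (simp add: LIMSEQ_const_iff)
  then show ?thesis by (simp add: rank_le1_iff)
qed

lemma tangent_coneI_segment:
  assumes "\<And>t. t > 0 \<Longrightarrow> X + t *\<^sub>R V \<in> S"
  shows "V \<in> tangent_cone S X"
  unfolding tangent_cone_def
  using assms LIMSEQ_inverse_real_of_nat
  by (auto intro!: exI[of _ "\<lambda>n. inverse (real (Suc n))"] exI[of _ "\<lambda>_. V"])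

text \<open>The linear condition forces the (2,2) entry of a tangent vector to be 0, so the distance
  is at least |q|, with equality only at \<open>diag2 p 0\<close>, which is tangent along a
  ray.\<close>

lemma proj_tangent_cone_diag2_fst:
  assumes "a \<noteq> 0"
  shows "proj (tangent_cone rank_le1 (diag2 a 0)) (diag2 p q) = {diag2 p 0}"
proof (rule proj_eq_singletonI)
  show "diag2 p 0 \<in> tangent_cone rank_le1 (diag2 a 0)"
    by (rule tangent_coneI_segment) (simp add: diag2_add_scaleR rank_le1_iff)
next
  fix Z assume Z: "Z \<in> tangent_cone rank_le1 (diag2 a 0)"
    and le: "norm (diag2 p q - Z) \<le> norm (diag2 p q - diag2 p 0)"
  have "Z$2$2 = 0"
    using tangent_cone_rank_le1_linear[OF _ Z] assms by (simp add: rank_le1_iff)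
  moreover have "(p - Z$1$1)\<^sup>2 + (Z$1$2)\<^sup>2 + (Z$2$1)\<^sup>2 + (q - Z$2$2)\<^sup>2 \<le> q\<^sup>2"
    using power_mono[OF le norm_ge_zero, of 2] by (simp add: norm_matrix_2_square)
  ultimately have "(p - Z$1$1)\<^sup>2 + (Z$1$2)\<^sup>2 + (Z$2$1)\<^sup>2 = 0"
    by (smt (verit) zero_le_power2)
  then show "Z = diag2 p 0"
    using \<open>Z$2$2 = 0\<close> by (simp add: add_nonneg_eq_0_iff matrix_2_eq_iff)
qed

lemma proj_tangent_cone_diag2_snd:
  assumes "b \<noteq> 0"
  shows "proj (tangent_cone rank_le1 (diag2 0 b)) (diag2 p q) = {diag2 0 q}"
proof (rule proj_eq_singletonI)
  show "diag2 0 q \<in> tangent_cone rank_le1 (diag2 0 b)"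
    by (rule tangent_coneI_segment) (simp add: diag2_add_scaleR rank_le1_iff)
next
  fix Z assume Z: "Z \<in> tangent_cone rank_le1 (diag2 0 b)"
    and le: "norm (diag2 p q - Z) \<le> norm (diag2 p q - diag2 0 q)"
  have "Z$1$1 = 0"
    using tangent_cone_rank_le1_linear[OF _ Z] assms by (simp add: rank_le1_iff)
  moreover have "(p - Z$1$1)\<^sup>2 + (Z$1$2)\<^sup>2 + (Z$2$1)\<^sup>2 + (q - Z$2$2)\<^sup>2 \<le> p\<^sup>2"
    using power_mono[OF le norm_ge_zero, of 2] by (simp add: norm_matrix_2_square)
  ultimately have "(Z$1$2)\<^sup>2 + (Z$2$1)\<^sup>2 + (q - Z$2$2)\<^sup>2 = 0"
    by (smt (verit) zero_le_power2)
  then show "Z = diag2 0 q"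
    using \<open>Z$1$1 = 0\<close> by (simp add: add_nonneg_eq_0_iff matrix_2_eq_iff)
qed

text \<open>
  For \<open>xw = yz\<close> the off-diagonal part satisfies \<open>y\<^sup>2 + z\<^sup>2 \<ge> 2\<bar>xw\<bar>\<close>, so the squared distance is at
  least \<open>p\<^sup>2 + (\<bar>x\<bar> + \<bar>w\<bar> - q)\<^sup>2 + 2(q - p)\<bar>x\<bar>\<close>.
\<close>

lemma proj_tangent_cone_zero:
  assumes "0 \<le> p" "p < q"
  shows "proj (tangent_cone rank_le1 0) (diag2 p q) = {diag2 0 q}"
proof (rule proj_eq_singletonI)
  show "diag2 0 q \<in> tangent_cone rank_le1 0"
    by (rule tangent_coneI_segment) (simp add: rank_le1_iff)
next
  fix Z assume Z: "Z \<in> tangent_cone rank_le1 0"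
    and le: "norm (diag2 p q - Z) \<le> norm (diag2 p q - diag2 0 q)"
  let ?x = "Z$1$1" and ?y = "Z$1$2" and ?z = "Z$2$1" and ?w = "Z$2$2"
  have det: "?x * ?w = ?y * ?z"
    using tangent_cone_rank_le1_zero[OF Z] by (simp add: rank_le1_iff)
  have le2: "(p - ?x)\<^sup>2 + ?y\<^sup>2 + ?z\<^sup>2 + (q - ?w)\<^sup>2 \<le> p\<^sup>2"
    using power_mono[OF le norm_ge_zero, of 2] by (simp add: norm_matrix_2_square)
  have yz: "?y\<^sup>2 + ?z\<^sup>2 = (\<bar>?y\<bar> - \<bar>?z\<bar>)\<^sup>2 + 2 * (\<bar>?x\<bar> * \<bar>?w\<bar>)"
    by (simp add: power2_diff flip: abs_mult det)
  \<comment> \<open>These nonnegative terms make up the excess of the squared distance over p^2.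
    Since p < q, \<open>e = 0\<close> forces x = 0; then \<open>d = 0\<close> and
    \<open>k = 0\<close> give w = q.\<close>
  define d e g h k where "d = (\<bar>?x\<bar> + \<bar>?w\<bar> - q)\<^sup>2" and "e = (q - p) * \<bar>?x\<bar>"
    and "g = (\<bar>?y\<bar> - \<bar>?z\<bar>)\<^sup>2" and "h = p * (\<bar>?x\<bar> - ?x)" and "k = q * (\<bar>?w\<bar> - ?w)"
  note defs = this
  have "(p - ?x)\<^sup>2 + ?y\<^sup>2 + ?z\<^sup>2 + (q - ?w)\<^sup>2 = p\<^sup>2 + d + 2 * e + g + 2 * h + 2 * k"
    using yz by (simp add: defs power2_eq_square algebra_simps)
  then have "d + 2 * e + g + 2 * h + 2 * k \<le> 0" using le2 by simp
  moreover have "d \<ge> 0" "e \<ge> 0" "g \<ge> 0" "h \<ge> 0" "k \<ge> 0" using assms by (simp_all add: defs)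
  ultimately have "d = 0" "e = 0" "k = 0" by linarith+
  then have x: "?x = 0" and "\<bar>?x\<bar> + \<bar>?w\<bar> = q" "\<bar>?w\<bar> = ?w"
    using assms by (simp_all add: defs)
  then have w: "?w = q" by simp
  then have "?y\<^sup>2 + ?z\<^sup>2 \<le> 0" using le2 x by simp
  then have "?y = 0" "?z = 0" by (auto simp: sum_power2_le_zero_iff)
  then show "Z = diag2 0 q" using x w by (simp add: matrix_2_eq_iff)
qed

section \<open>The steps of the two maps\<close>

lemma stat_measure_eqI:
  assumes "proj (tangent_cone rank_le1 A) (- gradient f A) = {G}"
  shows "stat_measure f A = norm G"
  using assms by (simp add: stat_measure_def)

text \<open>A feasible trial point is its own only projection, and the sufficient decrease rules out
  \<open>reduce\<close>.\<close>

lemma backtracking_accept_first: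
  assumes "A + \<alpha> *\<^sub>R G \<in> rank_le1"
    and "f (A + \<alpha> *\<^sub>R G) \<le> f A - c * \<alpha> * (stat_measure f A)\<^sup>2"
  shows "backtracking f \<beta> c A G \<alpha> Y \<longleftrightarrow> Y = A + \<alpha> *\<^sub>R G"
proof
  assume "backtracking f \<beta> c A G \<alpha> Y"
  then show "Y = A + \<alpha> *\<^sub>R G"
    by cases (use assms in \<open>auto simp: proj_self\<close>)
qed (use assms in \<open>auto intro!: backtracking.accept simp: proj_self\<close>)

text \<open>No choice remains: the direction is unique, the step interval is a single point, and the
  first trial is accepted. \<open>G \<noteq> 0\<close> makes \<open>A\<close>
  non-stationary.\<close>

lemma P2GD_singletonI:
  assumes "A \<in> rank_le1" "proj (tangent_cone rank_le1 A) (- gradient f A) = {G}" "G \<noteq> 0"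
    and "A + \<alpha> *\<^sub>R G \<in> rank_le1" "f (A + \<alpha> *\<^sub>R G) \<le> f A - c * \<alpha> * (norm G)\<^sup>2"
  shows "P2GD f \<alpha> \<alpha> \<beta> c A = {A + \<alpha> *\<^sub>R G}"
  using assms backtracking_accept_first[of A \<alpha> G f c \<beta>]
  by (auto simp: P2GD_def stat_measure_eqI)

lemma proj_rank_eq_self: "proj (rank_eq (rank A)) A = {A}"
  by (rule proj_self) (simp add: rank_eq_def)

lemma proj_rank_eq_0: "proj (rank_eq 0) A = {0}"
  by (rule proj_eq_singletonI) (auto simp: rank_eq_def rank_eq_0)

lemma P2GDR_no_reduction:
  assumes "rank A = 1" "rank_Delta \<Delta> A = 1" "stat_measure f A > 0"
    and "P2GD f \<alpha>min \<alpha>max \<beta> c A = {Y}"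
  shows "P2GDR f \<alpha>min \<alpha>max \<beta> c \<Delta> A = {Y}"
proof -
  have *: "proj (rank_eq (Suc 0)) A = {A}"
    using proj_rank_eq_self[of A] assms by simp
  have "(\<exists>Xhat Xtilde. (\<forall>j\<in>{0}. Xhat j \<in> proj (rank_eq (1 - j)) A \<and>
          Xtilde j \<in> P2GD f \<alpha>min \<alpha>max \<beta> c (Xhat j)) \<and>
          is_arg_min f (\<lambda>V. V \<in> Xtilde ` {0::nat}) W) \<longleftrightarrow> W = Y" (is "?L \<longleftrightarrow> _") for W
  proof
    assume "W = Y"
    then show ?L
      using assms
      by - (rule exI[of _ "\<lambda>_. A"], rule exI[of _ "\<lambda>_. Y"], auto simp: * is_arg_min_linorder)
  qed (use assms in \<open>auto simp: * is_arg_min_linorder\<close>)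
  then show ?thesis
    using assms unfolding P2GDR_def by (auto simp: rank_le1_def)
qed

text \<open>The index range is {0, 1}: index 0 keeps \<open>A\<close>, index 1 replaces it by the
  zero matrix, and \<open>f Z < f Y\<close> decides between the two outputs.\<close>

lemma P2GDR_one_reduction:
  assumes "rank A = 1" "rank_Delta \<Delta> A = 0" "stat_measure f A > 0"
    and "P2GD f \<alpha>min \<alpha>max \<beta> c A = {Y}" "P2GD f \<alpha>min \<alpha>max \<beta> c 0 = {Z}" "f Z < f Y"
  shows "P2GDR f \<alpha>min \<alpha>max \<beta> c \<Delta> A = {Z}"
proof -
  have *: "proj (rank_eq (Suc 0)) A = {A}"
    using proj_rank_eq_self[of A] assms by simp
  have **: "{0..Suc 0} = {0, 1}" by auto
  have "(\<exists>Xhat Xtilde. (\<forall>j\<in>{0, 1}. Xhat j \<in> proj (rank_eq (1 - j)) A \<and>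
          Xtilde j \<in> P2GD f \<alpha>min \<alpha>max \<beta> c (Xhat j)) \<and>
          is_arg_min f (\<lambda>V. V \<in> Xtilde ` {0, 1::nat}) W) \<longleftrightarrow> W = Z" (is "?L \<longleftrightarrow> _") for W
  proof
    assume "W = Z"
    then show ?L
      using assms
      by - (rule exI[of _ "\<lambda>j. if j = 0 then A else 0"], rule exI[of _ "\<lambda>j. if j = 0 then Y else Z"],
        auto simp: * proj_rank_eq_0 is_arg_min_linorder)
  qed (use assms in \<open>auto simp: * proj_rank_eq_0 is_arg_min_linorder\<close>)
  then show ?thesis
    using assms unfolding P2GDR_def by (auto simp: rank_le1_def **)
qed

text \<open>When each step has a single outcome, induction along a finite run shows that it agrees
  with \<open>X\<close>; positive stationarity prevents stopping.\<close>

lemma P2GDR_produces_deterministicI: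
  assumes "X0 \<in> rank_le1" "X 0 = X0"
    and "\<And>i. stat_measure f (X i) > 0"
    and "\<And>i. P2GDR f \<alpha>min \<alpha>max \<beta> c \<Delta> (X i) = {X (Suc i)}"
  shows "P2GDR_produces f \<alpha>min \<alpha>max \<beta> c \<Delta> X0 X"
proof -
  have "Y i = X i" if run: "P2GDR_run f \<alpha>min \<alpha>max \<beta> c \<Delta> X0 n Y" and "i \<le> n" for n Y i
    using \<open>i \<le> n\<close>
  proof (induction i)
    case 0
    then show ?case using run assms by (simp add: P2GDR_run_def)
  next
    case (Suc i)
    then have "Y (Suc i) \<in> P2GDR f \<alpha>min \<alpha>max \<beta> c \<Delta> (Y i)"
      using run Suc.prems unfolding P2GDR_run_def by (metis Suc_le_eq)
    moreover have "Y i = X i" using Suc by simp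
    ultimately show ?case using assms(4)[of i] by simp
  qed
  then show ?thesis
    using assms by (auto simp: P2GDR_produces_def P2GDR_run_def)
qed

section \<open>The cost function of the example\<close>

definition cost :: "real^2^2 \<Rightarrow> real" where
  "cost A = ((A$1$1 - 2)\<^sup>2 + (A$2$2 - 3)\<^sup>2 + (A$1$2 - A$2$1)\<^sup>2) / 2"

lemma cost_diag2: "cost (diag2 a b) = ((a - 2)\<^sup>2 + (b - 3)\<^sup>2) / 2"
  by (simp add: cost_def)

text \<open>The off-diagonal term of the cost is a square that vanishes at diagonal matrices, so it
  contributes nothing to the gradient there.\<close>

lemma gradient_cost_diag2: "gradient cost (diag2 a b) = diag2 (a - 2) (b - 3)"
proof (rule gradient_eqI)
  have nth: "((\<lambda>A::real^2^2. A$i$j) has_derivative (\<lambda>h. h$i$j)) F" for i j F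
    by (intro bounded_linear_imp_has_derivative bounded_linear_compose[OF bounded_linear_vec_nth]
        bounded_linear_vec_nth)
  show "GDERIV cost (diag2 a b) :> diag2 (a - 2) (b - 3)"
    unfolding gderiv_def cost_def
    by (rule derivative_eq_intros nth refl | simp)+
      (auto simp: fun_eq_iff inner_vec_def sum_2 field_simps)
qed

lemma minus_gradient_cost_diag2: "- gradient cost (diag2 a b) = diag2 (2 - a) (3 - b)"
  by (simp add: gradient_cost_diag2 uminus_diag2)

lemma norm_diag2_fst: "norm (diag2 a 0) = \<bar>a\<bar>"
  and norm_diag2_snd: "norm (diag2 0 b) = \<bar>b\<bar>"
  by (rule power2_eq_imp_eq; simp add: norm_matrix_2_square)+

lemma stat_measure_cost_fst: "a \<noteq> 0 \<Longrightarrow> stat_measure cost (diag2 a 0) = \<bar>2 - a\<bar>"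
  by (simp add: stat_measure_eqI minus_gradient_cost_diag2 proj_tangent_cone_diag2_fst norm_diag2_fst)

lemma stat_measure_cost_snd: "b \<noteq> 0 \<Longrightarrow> stat_measure cost (diag2 0 b) = \<bar>3 - b\<bar>"
  by (simp add: stat_measure_eqI minus_gradient_cost_diag2 proj_tangent_cone_diag2_snd norm_diag2_snd)

lemma rank_diag2_fst: "a \<noteq> 0 \<Longrightarrow> rank (diag2 a 0) = 1"
  and rank_diag2_snd: "b \<noteq> 0 \<Longrightarrow> rank (diag2 0 b) = 1"
  unfolding rank_eq_1_iff by (simp_all add: rank_le1_iff matrix_2_eq_iff)

text \<open>Twice the left side minus twice the right side is d^2 times \<alpha>(\<alpha> - 1) + 2(c
  - 1/2)\<alpha>, a sum of two nonpositive terms. Here \<open>d\<close> is the offset from the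
  minimizer along the line.\<close>

lemma armijo_quadratic:
  fixes \<alpha> c d :: real
  assumes "0 \<le> \<alpha>" "\<alpha> \<le> 1" "c \<le> 1/2"
  shows "((1 - \<alpha>) * d)\<^sup>2 / 2 \<le> d\<^sup>2 / 2 - c * \<alpha> * d\<^sup>2"
proof -
  have "(c - 1/2) * \<alpha> \<le> 0" "\<alpha> * (\<alpha> - 1) \<le> 0"
    using assms by (auto intro: mult_nonpos_nonneg mult_nonneg_nonpos simp del: mult_le_0_iff)
  then have "\<alpha> * (\<alpha> - 1) + 2 * ((c - 1/2) * \<alpha>) \<le> 0" by linarith
  then have "(\<alpha> * (\<alpha> - 1) + 2 * ((c - 1/2) * \<alpha>)) * d\<^sup>2 \<le> 0"
    by (intro mult_nonpos_nonneg) auto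
  then show ?thesis by (simp add: power2_eq_square field_simps)
qed

lemma P2GD_cost_fst:
  assumes "0 \<le> \<alpha>" "\<alpha> \<le> 1" "c \<le> 1/2" "a \<noteq> 0" "a \<noteq> 2"
  shows "P2GD cost \<alpha> \<alpha> \<beta> c (diag2 a 0) = {diag2 (a + \<alpha> * (2 - a)) 0}"
proof -
  have "a + \<alpha> * (2 - a) - 2 = (1 - \<alpha>) * (a - 2)" by (simp add: algebra_simps)
  then have "cost (diag2 (a + \<alpha> * (2 - a)) 0) \<le> cost (diag2 a 0) - c * \<alpha> * (norm (diag2 (2 - a) 0))\<^sup>2"
    using armijo_quadratic[OF assms(1-3), of "a - 2"]
    by (simp add: cost_diag2 norm_diag2_fst power2_commute[of 2 a] add_divide_distrib)
  then show ?thesis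
    using P2GD_singletonI[of "diag2 a 0" cost "diag2 (2 - a) 0" \<alpha> c \<beta>] assms
    by (simp add: rank_le1_iff minus_gradient_cost_diag2 proj_tangent_cone_diag2_fst
        diag2_add_scaleR matrix_2_eq_iff)
qed

lemma P2GD_cost_snd:
  assumes "0 \<le> \<alpha>" "\<alpha> \<le> 1" "c \<le> 1/2" "b \<noteq> 3"
  shows "P2GD cost \<alpha> \<alpha> \<beta> c (diag2 0 b) = {diag2 0 (b + \<alpha> * (3 - b))}"
proof -
  have "b + \<alpha> * (3 - b) - 3 = (1 - \<alpha>) * (b - 3)" by (simp add: algebra_simps)
  then have "cost (diag2 0 (b + \<alpha> * (3 - b))) \<le> cost (diag2 0 b) - c * \<alpha> * (norm (diag2 0 (3 - b)))\<^sup>2"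
    using armijo_quadratic[OF assms(1-3), of "b - 3"]
    by (simp add: cost_diag2 norm_diag2_snd power2_commute[of 3 b] add_divide_distrib)
  \<comment> \<open>The case \<open>b = 0\<close> is the rank-reduced start: the cone is then not
    linear, and the projection of diag(2,3) keeps the larger entry.\<close>
  moreover have "proj (tangent_cone rank_le1 (diag2 0 b)) (diag2 2 (3 - b)) = {diag2 0 (3 - b)}"
    using proj_tangent_cone_diag2_snd[of b] proj_tangent_cone_zero[of 2 3]
    by (cases "b = 0") (auto simp: zero_eq_diag2)
  ultimately show ?thesis
    using P2GD_singletonI[of "diag2 0 b" cost "diag2 0 (3 - b)" \<alpha> c \<beta>] assms
    by (simp add: rank_le1_iff minus_gradient_cost_diag2 diag2_add_scaleR matrix_2_eq_iff)
qed

lemma P2GDR_cost_start: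
  assumes "1/3 < \<alpha>" "\<alpha> < 1" "c \<le> 1/2"
  shows "P2GDR cost \<alpha> \<alpha> \<beta> c 1 (diag2 1 0) = {diag2 0 (3 * \<alpha>)}"
proof (rule P2GDR_one_reduction)
  show "rank (diag2 1 0) = 1" by (simp add: rank_diag2_fst)
  \<comment> \<open>The largest singular value equals the threshold 1, and the defining inequality
    is strict.\<close>
  show "rank_Delta 1 (diag2 1 0) = 0"
    by (simp add: rank_Delta_rank_1 rank_diag2_fst singular_values_diag2_fst)
  show "stat_measure cost (diag2 1 0) > 0" by (simp add: stat_measure_cost_fst)
  show "P2GD cost \<alpha> \<alpha> \<beta> c (diag2 1 0) = {diag2 (1 + \<alpha>) 0}"
    using P2GD_cost_fst[of \<alpha> c 1] assms by simp
  show "P2GD cost \<alpha> \<alpha> \<beta> c 0 = {diag2 0 (3 * \<alpha>)}"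
    using P2GD_cost_snd[of \<alpha> c 0] assms by (simp add: zero_eq_diag2 mult.commute)
  have "\<bar>1 - \<alpha>\<bar> \<le> \<bar>2/3\<bar>" using assms by simp
  then have "(1 - \<alpha>)\<^sup>2 \<le> (2/3)\<^sup>2" by (simp only: abs_le_square_iff)
  \<comment> \<open>With s = (1 - \<alpha>)^2, the cost comparison 4 + 9s < s + 9 amounts to 8s <
    5.\<close>
  then have "8 * (1 - \<alpha>)\<^sup>2 < 5" by (simp add: power2_eq_square)
  moreover have "cost (diag2 0 (3 * \<alpha>)) = (4 + 9 * (1 - \<alpha>)\<^sup>2) / 2"
    and "cost (diag2 (1 + \<alpha>) 0) = ((1 - \<alpha>)\<^sup>2 + 9) / 2"
    by (simp_all add: cost_diag2 power2_eq_square field_simps)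
  ultimately show "cost (diag2 0 (3 * \<alpha>)) < cost (diag2 (1 + \<alpha>) 0)" by simp
qed

lemma P2GDR_cost_snd:
  assumes "0 \<le> \<alpha>" "\<alpha> \<le> 1" "c \<le> 1/2" "1 < b" "b \<noteq> 3"
  shows "P2GDR cost \<alpha> \<alpha> \<beta> c 1 (diag2 0 b) = {diag2 0 (b + \<alpha> * (3 - b))}"
proof (rule P2GDR_no_reduction)
  show "rank (diag2 0 b) = 1" using assms by (simp add: rank_diag2_snd)
  then show "rank_Delta 1 (diag2 0 b) = 1"
    using assms by (simp add: rank_Delta_rank_1 singular_values_diag2_snd)
  show "stat_measure cost (diag2 0 b) > 0" using assms by (simp add: stat_measure_cost_snd)
  show "P2GD cost \<alpha> \<alpha> \<beta> c (diag2 0 b) = {diag2 0 (b + \<alpha> * (3 - b))}"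
    using assms by (simp add: P2GD_cost_snd)
qed

theorem proposition6:
  fixes \<alpha> \<beta> c \<Delta> :: real
    and f :: "real^2^2 \<Rightarrow> real"
    and X :: "nat \<Rightarrow> real^2^2"
  assumes "1/3 < \<alpha>" "\<alpha> < 1" and "0 < \<beta>" "\<beta> < 1" and "0 < c" "c \<le> 1/2" and "\<Delta> = 1"
    and f: "\<And>A. f A = ((A$1$1 - 2)\<^sup>2 + (A$2$2 - 3)\<^sup>2 + (A$1$2 - A$2$1)\<^sup>2) / 2"
    and X_0: "X 0 = diag2 1 0"
    and X_i: "\<And>i. i > 0 \<Longrightarrow> X i = diag2 0 (3 - 3 * (1 - \<alpha>)^i)"
  shows "P2GDR_produces f \<alpha> \<alpha> \<beta> c \<Delta> (diag2 1 0) X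
    \<and> X \<longlonglongrightarrow> diag2 0 3
    \<and> (\<lambda>i. stat_measure f (X i)) \<longlonglongrightarrow> 0
    \<and> stat_measure f (diag2 0 3) = 0"
proof -
  have f_cost: "f = cost" by (auto simp: f cost_def)
  \<comment> \<open>\<open>b\<close> describes \<open>X\<close> only from index 1 on:
    \<open>b 0\<close> is 0, whereas \<open>X 0\<close> is diag(1,0).\<close>
  define b where "b i = 3 - 3 * (1 - \<alpha>) ^ i" for i
  have X_b: "X i = diag2 0 (b i)" if "i > 0" for i
    using X_i[OF that] by (simp add: b_def)
  have b_lt: "b i < 3" for i
    using \<open>\<alpha> < 1\<close> by (simp add: b_def)
  have b_gt: "1 < b i" if "i > 0" for i
  proof -
    \<comment> \<open>Monotonicity reduces the bound to \<open>b 1\<close>, which is 3\<alpha> and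
      exceeds the threshold 1 because \<alpha> > 1/3.\<close>
    have "(1 - \<alpha>) ^ i \<le> (1 - \<alpha>) ^ 1"
      using assms that by (intro power_decreasing) auto
    then show ?thesis using assms by (simp add: b_def)
  qed
  have b_Suc: "b (Suc i) = b i + \<alpha> * (3 - b i)" for i
    by (simp add: b_def algebra_simps)
  have stat: "stat_measure f (X i) = 3 - b i" if "i > 0" for i
    using b_gt[OF that] b_lt[of i] by (simp add: f_cost X_b[OF that] stat_measure_cost_snd)
  have lim_b: "b \<longlonglongrightarrow> 3 - 3 * 0"
    unfolding b_def using assms by (intro tendsto_intros LIMSEQ_realpow_zero) auto
  have "P2GDR_produces f \<alpha> \<alpha> \<beta> c \<Delta> (diag2 1 0) X"
  proof (rule P2GDR_produces_deterministicI)
    show "diag2 1 0 \<in> rank_le1" by (simp add: rank_le1_iff)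
    show "stat_measure f (X i) > 0" for i
      using stat[of i] b_lt[of i] by (cases "i = 0") (auto simp: X_0 f_cost stat_measure_cost_fst)
    show "P2GDR f \<alpha> \<alpha> \<beta> c \<Delta> (X i) = {X (Suc i)}" for i
    proof (cases "i = 0")
      case True
      then show ?thesis
        using assms P2GDR_cost_start[of \<alpha> c \<beta>] by (simp add: f_cost X_b b_def)
    next
      case False
      then show ?thesis
        using assms P2GDR_cost_snd[of \<alpha> c "b i" \<beta>] b_gt[of i] b_lt[of i]
        by (simp add: f_cost X_b b_Suc)
    qed
  qed (rule X_0)
  moreover have "X \<longlonglongrightarrow> diag2 0 3"
  proof -
    have "b \<longlonglongrightarrow> 3" using lim_b by simp
    \<comment> \<open>Writing \<open>diag2 0 (b i)\<close> as an affine function of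
      \<open>b i\<close> lets the limit rules for scaling and addition apply.\<close>
    then have "(\<lambda>i. diag2 0 0 + b i *\<^sub>R diag2 0 1) \<longlonglongrightarrow> diag2 0 0 + 3 *\<^sub>R diag2 0 1"
      by (intro tendsto_intros)
    then have "(\<lambda>i. diag2 0 (b i)) \<longlonglongrightarrow> diag2 0 3" by (simp add: diag2_add_scaleR)
    moreover have "eventually (\<lambda>i. diag2 0 (b i) = X i) sequentially"
      using eventually_gt_at_top[of 0] by eventually_elim (simp add: X_b)
    ultimately show ?thesis by (rule Lim_transform_eventually)
  qed
  moreover have "(\<lambda>i. stat_measure f (X i)) \<longlonglongrightarrow> 0"
  proof (rule Lim_transform_eventually)
    show "(\<lambda>i. 3 - b i) \<longlonglongrightarrow> 0" using tendsto_diff[OF tendsto_const lim_b, of 3] by simp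
    show "eventually (\<lambda>i. 3 - b i = stat_measure f (X i)) sequentially"
      using eventually_gt_at_top[of 0] by eventually_elim (simp add: stat)
  qed
  \<comment> \<open>The negative gradient at diag(0,3) is diag(2,0), whose projection onto the
    tangent cone there is 0.\<close>
  moreover have "stat_measure f (diag2 0 3) = 0"
    by (simp add: f_cost stat_measure_cost_snd)
  ultimately show ?thesis by blast
qed

end
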